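(* Let $K\ge 1$, let $\mathcal{U}=\{U_k(\boldsymbol{\theta}_k)\}_{k=1}^K$ be parameterised sub-unitaries on $n$ qubits, let $\boldsymbol{\alpha}=\{\alpha_k\}_{k=1}^K$ be a probability distribution, let $\rho(\boldsymbol{x})$ be a data-encoded quantum state, and let $$\rho(\boldsymbol{\theta},\boldsymbol{\alpha},\boldsymbol{x})=\sum_{k=1}^K\alpha_k\,U_k(\boldsymbol{\theta}_k)\,\rho(\boldsymbol{x})\,U_k^\dagger(\boldsymbol{\theta}_k)$$ be the corresponding density quantum neural network state. Let $\mathcal{H}$ be a Hermitian observable and define the loss $$\mathcal{L}(\boldsymbol{\theta},\boldsymbol{\alpha},\boldsymbol{x})=\mathrm{Tr}\big(\mathcal{H}\,\rho(\boldsymbol{\theta},\boldsymbol{\alpha},\boldsymbol{x})\big).$$ For $\ell,k\in\{1,\dots,K\}$ let $T_{\ell k}$ be the number of circuits required to compute the gradient of sub-unitary $k$, $U_k(\boldsymbol{\theta}_k)$, with respect to the parameters $\boldsymbol{\theta}_\ell$ of sub-unitary $\ell$. Then an unbiased estimator of the gradients of $\mathcal{L}$ (with respect to the parameters $\boldsymbol{\theta}$) can be computed by classically post-processing $$\sum_{\ell=1}^K\sum_{k=1}^K T_{\ell k}$$ circuits. Furthermore, the parameters may be shared across the sub-unitaries, i.e. $\boldsymbol{\theta}_k=\boldsymbol{\theta}_{k'}$ is allowed for some $k,k'$.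
   Context: A density quantum neural network (density QNN) on $n$ qubits consists of a data-encoded density matrix $\rho(\boldsymbol{x})$ (usually $\rho(\boldsymbol{x})=|\boldsymbol{x}\rangle\langle\boldsymbol{x}|$ with $|\boldsymbol{x}\rangle=V(\boldsymbol{x})|0\rangle^{\otimes n}$ for a data-loading unitary $V(\boldsymbol{x})$), parameterised unitaries $U_k(\boldsymbol{\theta}_k)$ called sub-unitaries, where $\boldsymbol{\theta}_k$ is a real parameter vector with components $\theta_k^j$, and coefficients $\alpha_k\ge 0$ with $\sum_{k=1}^K\alpha_k=1$. The full parameter collection is $\boldsymbol{\theta}=\{\boldsymbol{\theta}_k\}_{k=1}^K$; some parameters of different sub-unitaries may coincide. The "gradient of sub-unitary $k$ with respect to $\boldsymbol{\theta}_\ell$" means the vector with components $\dfrac{\partial}{\partial\theta_\ell^j}\mathrm{Tr}\big(\mathcal{H}\,U_k(\boldsymbol{\theta}_k)\rho(\boldsymbol{x})U_k^\dagger(\boldsymbol{\theta}_k)\big)$. A gradient vector "can be computed with $T$ circuits" if there are $T$ quantum circuits such that classical post-processing of their measurement outcomes yields an unbiased estimator of that vector. The number of circuits counts distinct circuits, not repeated shots of the same circuit. *)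

theory Defs
  imports
    "HOL-Probability.Product_PMF"
    "Jordan_Normal_Form.Schur_Decomposition"
begin

hide_const (open) Finite_Cartesian_Product.mat Finite_Cartesian_Product.vec
  Finite_Cartesian_Product.row Finite_Cartesian_Product.column
no_notation Finite_Cartesian_Product.vec_nth (infixl "$" 90)

section \<open>States, unitaries and observables\<close>

text \<open>An \<open>n\<close>-qubit system has dimension \<open>2 ^ n\<close>; matrix indices are the computational basis
  states, with qubit strings read as binary numbers.\<close>

definition mat_trace :: "complex mat \<Rightarrow> complex" where
  "mat_trace A = (\<Sum>i<dim_row A. A $$ (i, i))"

definition hermitian_mat :: "nat \<Rightarrow> complex mat \<Rightarrow> bool" where
  "hermitian_mat N A \<longleftrightarrow> A \<in> carrier_mat N N \<and> mat_adjoint A = A"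

definition unitary_mat :: "nat \<Rightarrow> complex mat \<Rightarrow> bool" where
  "unitary_mat N W \<longleftrightarrow>
     W \<in> carrier_mat N N \<and> W * mat_adjoint W = 1\<^sub>m N \<and> mat_adjoint W * W = 1\<^sub>m N"

definition density_mat :: "nat \<Rightarrow> complex mat \<Rightarrow> bool" where
  "density_mat N \<rho> \<longleftrightarrow>
     hermitian_mat N \<rho> \<and> (\<forall>v\<in>carrier_vec N. Re ((\<rho> *\<^sub>v v) \<bullet>c v) \<ge> 0) \<and> mat_trace \<rho> = 1"

definition kron :: "complex mat \<Rightarrow> complex mat \<Rightarrow> complex mat" where
  "kron A B = Matrix.mat (dim_row A * dim_row B) (dim_col A * dim_col B)
     (\<lambda>(i, j). A $$ (i div dim_row B, j div dim_col B) * B $$ (i mod dim_row B, j mod dim_col B))"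

primrec kron_power :: "complex mat \<Rightarrow> nat \<Rightarrow> complex mat" where
  "kron_power A 0 = 1\<^sub>m 1"
| "kron_power A (Suc c) = kron A (kron_power A c)"

definition zero_state :: "nat \<Rightarrow> complex mat" where
  "zero_state a = Matrix.mat (2 ^ a) (2 ^ a) (\<lambda>(i, j). if i = 0 \<and> j = 0 then 1 else 0)"

section \<open>Quantum circuits and the gradients they can estimate\<close>

text \<open>A circuit prepares a number of copies of an input state and a number of ancilla qubits in
  the zero state, applies a unitary, and measures all qubits in the computational basis.
  By the principle of deferred measurement this also covers intermediate measurements and
  measurements of general observables.\<close>

datatype circuit = Circuit (copies: nat) (ancillas: nat) (gate: "complex mat")

definition circuits_on :: "nat \<Rightarrow> circuit set" where
  "circuits_on n = {c. unitary_mat (2 ^ (copies c * n + ancillas c)) (gate c)}"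

definition output_state :: "complex mat \<Rightarrow> circuit \<Rightarrow> complex mat" where
  "output_state \<rho> c =
     gate c * kron (kron_power \<rho> (copies c)) (zero_state (ancillas c)) * mat_adjoint (gate c)"

text \<open>The Born rule; see \<open>pmf_outcome_pmf\<close> below for the well-definedness of \<open>embed_pmf\<close> here.\<close>

definition outcome_pmf :: "complex mat \<Rightarrow> circuit \<Rightarrow> nat pmf" where
  "outcome_pmf \<rho> c =
     embed_pmf (\<lambda>b. if b < dim_row (gate c) then Re (output_state \<rho> c $$ (b, b)) else 0)"

text \<open>Independent runs of the circuits in \<open>C\<close>, with \<open>s c\<close> shots of circuit \<open>c\<close>.\<close>

definition runs_pmf ::
    "complex mat \<Rightarrow> circuit set \<Rightarrow> (circuit \<Rightarrow> nat) \<Rightarrow> (circuit \<times> nat \<Rightarrow> nat) pmf" where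
  "runs_pmf \<rho> C s = Pi_pmf (SIGMA c:C. {..<s c}) 0 (\<lambda>(c, i). outcome_pmf \<rho> c)"

text \<open>\<open>computable_with_circuits A \<rho> I g T\<close>: the vector \<open>g x\<close> with components \<open>g x i\<close> (\<open>i \<in> I\<close>)
  can be computed with \<open>T\<close> circuits, i.e. classical post-processing of the outcomes of (any
  number of shots of) at most \<open>T\<close> different circuits gives an unbiased estimator of it.
  \<open>A\<close> is the set of available circuits, which allows for any restriction on, say, the gate set.
  Circuits and post-processing are the same for all data points \<open>x\<close>, so that \<open>x\<close> is
  accessible only by measuring the encoded state \<open>\<rho> x\<close>. If they could depend on \<open>x\<close>, the
  post-processing could return the constant \<open>g x\<close> without running any circuit.\<close>

definition computable_with_circuits ::
    "circuit set \<Rightarrow> ('x \<Rightarrow> complex mat) \<Rightarrow> 'i set \<Rightarrow> ('x \<Rightarrow> 'i \<Rightarrow> real) \<Rightarrow> nat \<Rightarrow> bool" where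
  "computable_with_circuits A \<rho> I g T \<longleftrightarrow>
     (\<exists>C s (post :: (circuit \<times> nat \<Rightarrow> nat) \<Rightarrow> 'i \<Rightarrow> real).
        C \<subseteq> A \<and> finite C \<and> card C \<le> T \<and>
        (\<forall>x. \<forall>i\<in>I. measure_pmf.expectation (runs_pmf (\<rho> x) C s) (\<lambda>\<omega>. post \<omega> i) = g x i))"

section \<open>Density quantum neural networks\<close>

definition evolve :: "complex mat \<Rightarrow> complex mat \<Rightarrow> complex mat" where
  "evolve W \<rho> = W * \<rho> * mat_adjoint W"

text \<open>The trace below is real for Hermitian \<open>H\<close> and \<open>\<sigma>\<close>; see \<open>trace_hermitian_real\<close>.\<close>

definition expected_value :: "complex mat \<Rightarrow> complex mat \<Rightarrow> real" where
  "expected_value H \<sigma> = Re (mat_trace (H * \<sigma>))"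

definition dqnn_state ::
    "nat \<Rightarrow> nat \<Rightarrow> (nat \<Rightarrow> real vec \<Rightarrow> complex mat) \<Rightarrow> (nat \<Rightarrow> real vec) \<Rightarrow> (nat \<Rightarrow> real)
     \<Rightarrow> complex mat \<Rightarrow> complex mat" where
  "dqnn_state n K U \<theta> \<alpha> \<rho> = Matrix.mat (2 ^ n) (2 ^ n)
     (\<lambda>ij. \<Sum>k=1..K. complex_of_real (\<alpha> k) * evolve (U k (\<theta> k)) \<rho> $$ ij)"

definition dqnn_loss ::
    "complex mat \<Rightarrow> nat \<Rightarrow> nat \<Rightarrow> (nat \<Rightarrow> real vec \<Rightarrow> complex mat) \<Rightarrow> (nat \<Rightarrow> real vec)
     \<Rightarrow> (nat \<Rightarrow> real) \<Rightarrow> complex mat \<Rightarrow> real" where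
  "dqnn_loss H n K U \<theta> \<alpha> \<rho> = expected_value H (dqnn_state n K U \<theta> \<alpha> \<rho>)"

text \<open>Parameters may be shared: \<open>w :: 'p \<Rightarrow> real\<close> assigns values to the independent parameters,
  and component \<open>j\<close> of the parameter vector of sub-unitary \<open>k\<close>, of dimension \<open>d k\<close>, is the
  independent parameter named \<open>\<pi> k j\<close>. Names may coincide for different \<open>k\<close> (and \<open>j\<close>); without
  any sharing, \<open>\<pi>\<close> is injective in \<open>(k, j)\<close>.\<close>

definition params :: "(nat \<Rightarrow> nat) \<Rightarrow> (nat \<Rightarrow> nat \<Rightarrow> 'p) \<Rightarrow> ('p \<Rightarrow> real) \<Rightarrow> nat \<Rightarrow> real vec" where
  "params d \<pi> w k = Matrix.vec (d k) (\<lambda>j. w (\<pi> k j))"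

definition has_partial :: "(('p \<Rightarrow> real) \<Rightarrow> real) \<Rightarrow> 'p \<Rightarrow> ('p \<Rightarrow> real) \<Rightarrow> bool" where
  "has_partial f p w \<longleftrightarrow> (\<lambda>t. f (w(p := t))) field_differentiable at (w p)"

definition partial :: "(('p \<Rightarrow> real) \<Rightarrow> real) \<Rightarrow> 'p \<Rightarrow> ('p \<Rightarrow> real) \<Rightarrow> real" where
  "partial f p w = deriv (\<lambda>t. f (w(p := t))) (w p)"

section \<open>Well-definedness\<close>

lemma dim_mat_adjoint [simp]:
  "dim_row (mat_adjoint A) = dim_col A" "dim_col (mat_adjoint A) = dim_row A"
  by (auto simp: mat_adjoint_def)

lemma index_mat_adjoint [simp]:
  fixes A :: "complex mat"
  shows "i < dim_col A \<Longrightarrow> j < dim_row A \<Longrightarrow> mat_adjoint A $$ (i, j) = cnj (A $$ (j, i))"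
  by (simp add: mat_adjoint_def mat_of_rows_def)

lemma mat_adjoint_carrier: "A \<in> carrier_mat N M \<Longrightarrow> mat_adjoint A \<in> carrier_mat M N"
  by (metis carrier_matD carrier_matI dim_mat_adjoint)

lemma mat_adjoint_mult:
  fixes A B :: "complex mat"
  assumes "A \<in> carrier_mat N M" "B \<in> carrier_mat M L"
  shows "mat_adjoint (A * B) = mat_adjoint B * mat_adjoint A"
  by (rule eq_matI) (use assms in \<open>auto simp: scalar_prod_def intro!: sum.cong\<close>)

lemma mat_trace_comm:
  assumes "A \<in> carrier_mat N M" "B \<in> carrier_mat M N"
  shows "mat_trace (A * B) = mat_trace (B * A)"
proof -
  have "mat_trace (A * B) = (\<Sum>i<N. \<Sum>j<M. A $$ (i, j) * B $$ (j, i))"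
    using assms by (auto simp: mat_trace_def scalar_prod_def atLeast0LessThan intro!: sum.cong)
  also have "\<dots> = (\<Sum>j<M. \<Sum>i<N. B $$ (j, i) * A $$ (i, j))"
    by (subst sum.swap) (simp add: mult.commute)
  also have "\<dots> = mat_trace (B * A)"
    using assms by (auto simp: mat_trace_def scalar_prod_def atLeast0LessThan intro!: sum.cong)
  finally show ?thesis .
qed

lemma trace_hermitian_real:
  assumes "hermitian_mat N H" "hermitian_mat N \<sigma>"
  shows "mat_trace (H * \<sigma>) \<in> \<real>"
proof -
  have c: "H \<in> carrier_mat N N" "\<sigma> \<in> carrier_mat N N"
    and h: "mat_adjoint H = H" "mat_adjoint \<sigma> = \<sigma>"
    using assms by (auto simp: hermitian_mat_def)
  have "cnj (mat_trace (H * \<sigma>)) = mat_trace (mat_adjoint (H * \<sigma>))"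
    using c by (simp add: mat_trace_def)
  also have "\<dots> = mat_trace (\<sigma> * H)"
    by (simp add: mat_adjoint_mult[OF c] h)
  also have "\<dots> = mat_trace (H * \<sigma>)"
    by (rule mat_trace_comm[OF c(2,1)])
  finally show ?thesis
    by (simp add: Reals_cnj_iff)
qed

lemma sum_single:
  fixes f :: "nat \<Rightarrow> 'a :: comm_monoid_add"
  assumes "i < N" "\<And>k. k < N \<Longrightarrow> k \<noteq> i \<Longrightarrow> f k = 0"
  shows "(\<Sum>k<N. f k) = f i"
proof -
  have "(\<Sum>k<N. f k) = (\<Sum>k\<in>{i}. f k)"
    using assms by (intro sum.mono_neutral_right) auto
  then show ?thesis by simp
qed

text \<open>Cholesky factorisation, used to see that Kronecker products of positive semidefinite
  matrices are positive semidefinite.\<close>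

lemma psd_factor:
  fixes a :: "nat \<Rightarrow> nat \<Rightarrow> complex"
  assumes "\<And>i j. i < N \<Longrightarrow> j < N \<Longrightarrow> a j i = cnj (a i j)"
    and "\<And>v. Re (\<Sum>i<N. \<Sum>j<N. cnj (v i) * a i j * v j) \<ge> 0"
  shows "\<exists>u. \<forall>i<N. \<forall>j<N. a i j = (\<Sum>m<N. u i m * cnj (u j m))"
  using assms
proof (induction N arbitrary: a)
  case 0
  show ?case by simp
next
  case (Suc N)
  note herm = Suc.prems(1)
  have psd: "Re ((\<Sum>i<N. \<Sum>j<N. cnj (v i) * a i j * v j) + (\<Sum>i<N. cnj (v i) * a i N * z)
      + (\<Sum>j<N. cnj z * a N j * v j) + cnj z * a N N * z) \<ge> 0" for v z
    using Suc.prems(2)[of "v(N := z)"] by (simp add: sum.distrib algebra_simps)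
  have "a N N = cnj (a N N)" using herm[of N N] by simp
  then obtain r where r: "a N N = complex_of_real r" by (metis Reals_cnj_iff Reals_cases)
  have r0: "r \<ge> 0" using psd[of "\<lambda>_. 0" 1] by (simp add: r)
  show ?case
  proof (cases "r = 0")
    case True
    have z: "a i N = 0" if i: "i < N" for i
    proof (rule ccontr)
      assume ne: "a i N \<noteq> 0"
      let ?q = "(cmod (a i N))\<^sup>2"
      have q: "?q > 0" using ne by simp
      have aNi: "a N i = cnj (a i N)" using herm[of i N] i by simp
      have *: "Re (a i i) - 2 * t * ?q \<ge> 0" for t
      proof -
        let ?v = "\<lambda>j. if j = i then 1 else (0::complex)"
        let ?z = "- complex_of_real t * cnj (a i N)"
        have 1: "(\<Sum>k<N. \<Sum>j<N. cnj (?v k) * a k j * ?v j) = a i i"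
          by (subst sum_single[OF i], simp, subst sum_single[OF i]) simp_all
        have 2: "(\<Sum>k<N. cnj (?v k) * a k N * ?z) = a i N * ?z"
          by (subst sum_single[OF i]) simp_all
        have 3: "(\<Sum>j<N. cnj ?z * a N j * ?v j) = cnj ?z * a N i"
          by (subst sum_single[OF i]) simp_all
        have n: "a i N * cnj (a i N) = complex_of_real ?q"
          by (simp only: complex_norm_square)
        have 4: "a i N * ?z = - complex_of_real (t * ?q)"
          using n by (simp add: mult_ac)
        have 5: "cnj ?z * a N i = - complex_of_real (t * ?q)"
          using n by (simp add: mult_ac aNi)
        have "Re (a i i + - complex_of_real (t * ?q) + - complex_of_real (t * ?q)) \<ge> 0"
          using psd[of ?v ?z] unfolding 1 2 3 4 5 by (simp only: r True) simp
        then show ?thesis by simp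
      qed
      have "Re (a i i) - 2 * ((Re (a i i) + 1) / (2 * ?q)) * ?q = -1"
        using ne by (simp add: field_simps)
      with *[of "(Re (a i i) + 1) / (2 * ?q)"] show False by linarith
    qed
    have z': "a N i = 0" if i: "i < N" for i using herm[of i N] z[OF i] i by simp
    have p0: "Re (\<Sum>i<N. \<Sum>j<N. cnj (v i) * a i j * v j) \<ge> 0" for v
      using psd[of v 0] by simp
    obtain u where u: "\<And>i j. i < N \<Longrightarrow> j < N \<Longrightarrow> a i j = (\<Sum>m<N. u i m * cnj (u j m))"
      using Suc.IH[of a, OF herm p0] less_SucI by meson
    define u' where "u' i m = (if i < N \<and> m < N then u i m else 0)" for i m
    have "a i j = (\<Sum>m<Suc N. u' i m * cnj (u' j m))" if ij: "i < Suc N" "j < Suc N" for i j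
    proof (cases "i < N \<and> j < N")
      case True
      then show ?thesis using u[of i j] by (simp add: u'_def)
    next
      case False
      then have "i = N \<or> j = N" using ij by auto
      moreover from this have "a i j = 0" using ij z[of i] z'[of j] r \<open>r = 0\<close>
        by (metis less_SucE of_real_0)
      ultimately show ?thesis by (auto simp: u'_def intro!: sum.neutral)
    qed
    then show ?thesis by blast
  next
    case False
    with r0 have rp: "r > 0" by simp
    define b where "b i j = a i j - a i N * a N j / complex_of_real r" for i j
    have bh: "b j i = cnj (b i j)" if "i < N" "j < N" for i j
    proof -
      have "a j i = cnj (a i j)" "a j N = cnj (a N j)" "a N i = cnj (a i N)"
        using herm[of i j] herm[of N j] herm[of i N] that by auto
      then show ?thesis by (simp add: b_def mult.commute)
    qed
    have bp: "Re (\<Sum>i<N. \<Sum>j<N. cnj (v i) * b i j * v j) \<ge> 0" for v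
    proof -
      define y where "y = (\<Sum>j<N. a N j * v j)"
      have y: "(\<Sum>i<N. cnj (v i) * a i N) = cnj y"
        unfolding y_def cnj_sum
      proof (rule sum.cong)
        fix i assume "i \<in> {..<N}"
        then have "a i N = cnj (a N i)" using herm[of N i] by simp
        then show "cnj (v i) * a i N = cnj (a N i * v i)" by simp
      qed simp
      let ?z = "- y / complex_of_real r"
      have s2: "(\<Sum>i<N. cnj (v i) * a i N * ?z) = cnj y * ?z"
        unfolding y[symmetric] by (rule sum_distrib_right[symmetric])
      have s3: "(\<Sum>j<N. cnj ?z * a N j * v j) = cnj ?z * y"
        unfolding y_def by (simp add: sum_distrib_left mult.assoc)
      have "(\<Sum>i<N. \<Sum>j<N. cnj (v i) * b i j * v j)
          = (\<Sum>i<N. \<Sum>j<N. cnj (v i) * a i j * v j)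
            - (\<Sum>i<N. \<Sum>j<N. (cnj (v i) * a i N) * (a N j * v j)) / complex_of_real r"
        by (simp add: b_def algebra_simps sum_subtractf sum_divide_distrib)
      also have "(\<Sum>i<N. \<Sum>j<N. (cnj (v i) * a i N) * (a N j * v j)) = cnj y * y"
        by (simp only: sum_product[symmetric] y y_def[symmetric])
      also have "(\<Sum>i<N. \<Sum>j<N. cnj (v i) * a i j * v j) - cnj y * y / complex_of_real r
          = (\<Sum>i<N. \<Sum>j<N. cnj (v i) * a i j * v j) + cnj y * ?z + cnj ?z * y
            + cnj ?z * a N N * ?z"
        using rp by (simp add: r field_simps)
      finally show ?thesis using psd[of v ?z] unfolding s2 s3 by simp
    qed
    obtain u where u: "\<And>i j. i < N \<Longrightarrow> j < N \<Longrightarrow> b i j = (\<Sum>m<N. u i m * cnj (u j m))"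
      using Suc.IH[of b, OF bh bp] by meson
    define w where "w i = a i N / complex_of_real (sqrt r)" for i
    define u' where "u' i m = (if m = N then w i else if i < N then u i m else 0)" for i m
    have sq: "complex_of_real (sqrt r) * complex_of_real (sqrt r) = complex_of_real r"
      using rp by (simp flip: of_real_mult)
    have w: "w i * cnj (w j) = a i N * a N j / complex_of_real r" if "j < Suc N" for i j
    proof -
      have "a N j = cnj (a j N)" using herm[of j N] that by simp
      then show ?thesis by (simp add: w_def sq)
    qed
    have "a i j = (\<Sum>m<Suc N. u' i m * cnj (u' j m))" if ij: "i < Suc N" "j < Suc N" for i j
    proof -
      have "(\<Sum>m<N. u' i m * cnj (u' j m)) = b i j"
      proof (cases "i < N \<and> j < N")
        case True
        then show ?thesis using u by (simp add: u'_def)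
      next
        case False
        then have "i = N \<or> j = N" using ij by auto
        then have "b i j = 0" using rp by (auto simp: b_def r)
        moreover have "(\<Sum>m<N. u' i m * cnj (u' j m)) = 0"
          using \<open>i = N \<or> j = N\<close> by (auto simp: u'_def intro!: sum.neutral)
        ultimately show ?thesis by simp
      qed
      then show ?thesis using w[OF ij(2)] by (simp add: u'_def b_def)
    qed
    then show ?thesis by blast
  qed
qed

lemma density_mat_factor:
  assumes "density_mat N \<rho>"
  obtains F where "F \<in> carrier_mat N N" "\<rho> = F * mat_adjoint F"
proof -
  have c: "\<rho> \<in> carrier_mat N N" and h: "mat_adjoint \<rho> = \<rho>"
    and p: "\<And>v. v \<in> carrier_vec N \<Longrightarrow> Re ((\<rho> *\<^sub>v v) \<bullet>c v) \<ge> 0"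
    using assms by (auto simp: density_mat_def hermitian_mat_def)
  have "\<rho> $$ (j, i) = cnj (\<rho> $$ (i, j))" if "i < N" "j < N" for i j
    using that c index_mat_adjoint[of j \<rho> i] h by auto
  moreover have "Re (\<Sum>i<N. \<Sum>j<N. cnj (v i) * \<rho> $$ (i, j) * v j) \<ge> 0" for v
  proof -
    have "(\<rho> *\<^sub>v Matrix.vec N v) \<bullet>c Matrix.vec N v
        = (\<Sum>i<N. \<Sum>j<N. cnj (v i) * \<rho> $$ (i, j) * v j)"
      using c by (auto simp: scalar_prod_def atLeast0LessThan sum_distrib_left mult_ac
          intro!: sum.cong)
    then show ?thesis using p[of "Matrix.vec N v"] by simp
  qed
  ultimately obtain u where
    u: "\<And>i j. i < N \<Longrightarrow> j < N \<Longrightarrow> \<rho> $$ (i, j) = (\<Sum>m<N. u i m * cnj (u j m))"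
    using psd_factor[of N "\<lambda>i j. \<rho> $$ (i, j)"] by blast
  define F where "F = Matrix.mat N N (\<lambda>(i, j). u i j)"
  have "\<rho> = F * mat_adjoint F"
    by (rule eq_matI) (use c u in \<open>auto simp: F_def scalar_prod_def atLeast0LessThan\<close>)
  then show ?thesis using that[of F] by (simp add: F_def)
qed

lemma dim_kron [simp]:
  "dim_row (kron A B) = dim_row A * dim_row B" "dim_col (kron A B) = dim_col A * dim_col B"
  by (simp_all add: kron_def)

lemma index_kron [simp]:
  "i < dim_row A * dim_row B \<Longrightarrow> j < dim_col A * dim_col B \<Longrightarrow> kron A B $$ (i, j) =
     A $$ (i div dim_row B, j div dim_col B) * B $$ (i mod dim_row B, j mod dim_col B)"
  by (simp add: kron_def)

lemma sum_div_mod: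
  fixes f g :: "nat \<Rightarrow> 'a :: comm_semiring_0"
  shows "(\<Sum>m<M * L. f (m div L) * g (m mod L)) = (\<Sum>m<M. f m) * (\<Sum>l<L. g l)"
proof (cases "L = 0")
  case False
  then show ?thesis
    by (subst sum_mult_product) (simp add: sum_product)
qed simp

lemma div_mod_less:
  fixes i :: nat
  assumes "i < M * L"
  shows "i div L < M" "i mod L < L"
proof -
  show "i div L < M"
    using assms by (simp add: less_mult_imp_div_less)
  have "L \<noteq> 0" using assms by (metis mult_0_right not_less0)
  then show "i mod L < L" by simp
qed

lemma kron_gram:
  fixes A B :: "complex mat"
  shows "kron (A * mat_adjoint A) (B * mat_adjoint B) = kron A B * mat_adjoint (kron A B)"
proof (rule eq_matI)
  fix i j
  assume "i < dim_row (kron A B * mat_adjoint (kron A B))"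
    "j < dim_col (kron A B * mat_adjoint (kron A B))"
  then have ij: "i < dim_row A * dim_row B" "j < dim_row A * dim_row B" by auto
  note d = div_mod_less[OF ij(1)] div_mod_less[OF ij(2)]
  let ?L = "dim_col B"
  have "(kron A B * mat_adjoint (kron A B)) $$ (i, j)
      = (\<Sum>m<dim_col A * ?L. kron A B $$ (i, m) * cnj (kron A B $$ (j, m)))"
    using ij by (simp add: scalar_prod_def atLeast0LessThan)
  also have "\<dots> = (\<Sum>m<dim_col A * ?L.
      (A $$ (i div dim_row B, m div ?L) * cnj (A $$ (j div dim_row B, m div ?L)))
      * (B $$ (i mod dim_row B, m mod ?L) * cnj (B $$ (j mod dim_row B, m mod ?L))))"
    using ij by (intro sum.cong) auto
  also have "\<dots> = (\<Sum>m<dim_col A. A $$ (i div dim_row B, m) * cnj (A $$ (j div dim_row B, m)))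
      * (\<Sum>m<?L. B $$ (i mod dim_row B, m) * cnj (B $$ (j mod dim_row B, m)))"
    by (rule sum_div_mod[where L = ?L])
  also have "\<dots> = kron (A * mat_adjoint A) (B * mat_adjoint B) $$ (i, j)"
    using ij d by (simp add: scalar_prod_def atLeast0LessThan)
  finally show "kron (A * mat_adjoint A) (B * mat_adjoint B) $$ (i, j)
      = (kron A B * mat_adjoint (kron A B)) $$ (i, j)" by simp
qed auto

lemma mat_trace_kron:
  assumes "A \<in> carrier_mat M M" "B \<in> carrier_mat L L"
  shows "mat_trace (kron A B) = mat_trace A * mat_trace B"
proof -
  have "mat_trace (kron A B) = (\<Sum>m<M * L. A $$ (m div L, m div L) * B $$ (m mod L, m mod L))"
    using assms by (auto simp: mat_trace_def)
  also have "\<dots> = mat_trace A * mat_trace B"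
    using assms sum_div_mod[where M = M and L = L and f = "\<lambda>m. A $$ (m, m)" and g = "\<lambda>m. B $$ (m, m)"]
    by (simp add: mat_trace_def)
  finally show ?thesis .
qed

text \<open>Positive semidefinite with unit trace, in factorised form.\<close>

definition gram_state :: "nat \<Rightarrow> complex mat \<Rightarrow> bool" where
  "gram_state N R \<longleftrightarrow>
     (\<exists>M F. F \<in> carrier_mat N M \<and> R = F * mat_adjoint F) \<and> mat_trace R = 1"

lemma gram_state_carrier: "gram_state N R \<Longrightarrow> R \<in> carrier_mat N N"
  unfolding gram_state_def by (metis mat_adjoint_carrier mult_carrier_mat)

lemma gram_state_kron:
  assumes "gram_state N R" "gram_state N' R'"
  shows "gram_state (N * N') (kron R R')"
proof -
  obtain M F M' F' where F: "F \<in> carrier_mat N M" "R = F * mat_adjoint F"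
    "F' \<in> carrier_mat N' M'" "R' = F' * mat_adjoint F'"
    using assms by (auto simp: gram_state_def)
  have "kron F F' \<in> carrier_mat (N * N') (M * M')" using F by auto
  moreover have "kron R R' = kron F F' * mat_adjoint (kron F F')" by (simp add: F kron_gram)
  moreover have "mat_trace (kron R R') = 1"
    using mat_trace_kron[OF gram_state_carrier[OF assms(1)] gram_state_carrier[OF assms(2)]] assms
    by (simp add: gram_state_def)
  ultimately show ?thesis unfolding gram_state_def by blast
qed

lemma gram_state_kron_power:
  assumes "density_mat (2 ^ n) \<rho>"
  shows "gram_state (2 ^ (c * n)) (kron_power \<rho> c)"
proof (induction c)
  case 0
  have "(1\<^sub>m 1 :: complex mat) = 1\<^sub>m 1 * mat_adjoint (1\<^sub>m 1)" by (rule eq_matI) auto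
  moreover have "mat_trace (1\<^sub>m 1) = 1" by (simp add: mat_trace_def)
  ultimately have "gram_state 1 (1\<^sub>m 1)" unfolding gram_state_def by (metis one_carrier_mat)
  then show ?case by simp
next
  case (Suc c)
  have "gram_state (2 ^ n) \<rho>"
    using assms density_mat_factor[OF assms] unfolding gram_state_def density_mat_def by metis
  from gram_state_kron[OF this Suc] show ?case by (simp add: power_add)
qed

lemma gram_state_zero: "gram_state (2 ^ a) (zero_state a)"
proof -
  let ?F = "Matrix.mat (2 ^ a) 1 (\<lambda>(i, j). if i = 0 then 1 else (0 :: complex))"
  have "zero_state a = ?F * mat_adjoint ?F"
    by (rule eq_matI) (auto simp: zero_state_def scalar_prod_def)
  moreover have "mat_trace (zero_state a) = (\<Sum>i<2 ^ a :: nat. if i = 0 then 1 else 0)"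
    by (simp add: mat_trace_def zero_state_def)
  then have "mat_trace (zero_state a) = 1" by simp
  ultimately show ?thesis unfolding gram_state_def by (metis mat_carrier)
qed

lemma gram_state_conj:
  assumes "gram_state N R" "unitary_mat N W"
  shows "gram_state N (W * R * mat_adjoint W)"
proof -
  obtain M F where F: "F \<in> carrier_mat N M" "R = F * mat_adjoint F"
    using assms by (auto simp: gram_state_def)
  have W: "W \<in> carrier_mat N N" "mat_adjoint W * W = 1\<^sub>m N"
    using assms by (auto simp: unitary_mat_def)
  have cF: "mat_adjoint F \<in> carrier_mat M N" and cW: "mat_adjoint W \<in> carrier_mat N N"
    and R: "R \<in> carrier_mat N N"
    using F W gram_state_carrier[OF assms(1)] by (auto intro: mat_adjoint_carrier)
  have "W * R * mat_adjoint W = (W * F) * mat_adjoint (W * F)"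
    unfolding mat_adjoint_mult[OF W(1) F(1)] F(2)
    using assoc_mult_mat[OF W(1) F(1), of "mat_adjoint F * mat_adjoint W" N]
      assoc_mult_mat[OF F(1) cF cW] assoc_mult_mat[OF W(1), of "F * mat_adjoint F" N "mat_adjoint W" N]
      F(1) cF cW by simp
  moreover have "W * F \<in> carrier_mat N M" using W F by auto
  moreover have "mat_trace (W * R * mat_adjoint W) = mat_trace (mat_adjoint W * (W * R))"
    using W R cW by (intro mat_trace_comm) auto
  moreover have "mat_adjoint W * (W * R) = R"
    using W R cW assoc_mult_mat[OF cW W(1) R] by simp
  ultimately show ?thesis using assms(1) unfolding gram_state_def by auto
qed

lemma gram_state_output:
  assumes "density_mat (2 ^ n) \<rho>" "c \<in> circuits_on n"
  shows "gram_state (2 ^ (copies c * n + ancillas c)) (output_state \<rho> c)"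
  unfolding output_state_def
  using gram_state_conj[OF gram_state_kron[OF gram_state_kron_power[OF assms(1)] gram_state_zero]]
    assms(2) by (simp add: circuits_on_def power_add)

lemma gram_state_diag:
  assumes "gram_state N R" "b < N"
  shows "Re (R $$ (b, b)) \<ge> 0"
proof -
  obtain M F where F: "F \<in> carrier_mat N M" "R = F * mat_adjoint F"
    using assms by (auto simp: gram_state_def)
  then have "R $$ (b, b) = (\<Sum>m<M. F $$ (b, m) * cnj (F $$ (b, m)))"
    using assms(2) by (auto simp: scalar_prod_def atLeast0LessThan)
  then show ?thesis by (simp add: sum_nonneg flip: complex_norm_square)
qed

lemma pmf_outcome_pmf:
  assumes "density_mat (2 ^ n) \<rho>" "c \<in> circuits_on n"
  shows "pmf (outcome_pmf \<rho> c) b =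
    (if b < dim_row (gate c) then Re (output_state \<rho> c $$ (b, b)) else 0)"
proof -
  let ?N = "2 ^ (copies c * n + ancillas c)"
  let ?f = "\<lambda>b. if b < dim_row (gate c) then Re (output_state \<rho> c $$ (b, b)) else 0"
  note g = gram_state_output[OF assms]
  have N: "dim_row (gate c) = ?N" using assms by (auto simp: circuits_on_def unitary_mat_def)
  have nn: "?f b \<ge> 0" for b using gram_state_diag[OF g] N by auto
  have "(\<Sum>b<?N. ?f b) = Re (mat_trace (output_state \<rho> c))"
    using gram_state_carrier[OF g] N by (auto simp: mat_trace_def)
  then have s: "(\<Sum>b<?N. ?f b) = 1" using g by (simp add: gram_state_def)
  have "(\<integral>\<^sup>+ b. ennreal (?f b) \<partial>count_space UNIV) = (\<Sum>b<?N. ennreal (?f b))"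
    by (rule nn_integral_count_space') (auto simp: N)
  also have "\<dots> = 1" using nn s by (subst sum_ennreal) auto
  finally show ?thesis unfolding outcome_pmf_def by (intro pmf_embed_pmf nn)
qed

end

theory Submission
  imports Defs
begin

text \<open>The loss is the \<open>\<alpha>\<close>-weighted sum of the expected values for the sub-unitaries, so its partial
  derivatives are the same weighted sums of theirs. Run the union of all the given circuits, each
  with enough shots for every one of the given estimators; each estimator sees only its own shots.
  The weighted sum of the estimators is unbiased because expectation is linear, which needs no
  independence, so that circuits and parameters may be shared. Integrability is clear as there are
  only finitely many outcomes.\<close>

lemma finite_set_outcome_pmf:
  assumes "density_mat (2 ^ n) \<rho>" "c \<in> circuits_on n"
  shows "finite (set_pmf (outcome_pmf \<rho> c))"
proof (rule finite_subset)
  show "set_pmf (outcome_pmf \<rho> c) \<subseteq> {..<dim_row (gate c)}"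
    by (auto simp: set_pmf_iff pmf_outcome_pmf[OF assms] split: if_splits)
qed simp

lemma finite_set_runs_pmf:
  assumes "density_mat (2 ^ n) \<rho>" "C \<subseteq> circuits_on n" "finite C"
  shows "finite (set_pmf (runs_pmf \<rho> C s))"
proof -
  have "finite (SIGMA c:C. {..<s c})" using assms(3) by simp
  then show ?thesis
    using assms(1,2) unfolding runs_pmf_def
    by (subst set_Pi_pmf) (auto intro!: finite_PiE_dflt finite_set_outcome_pmf)
qed

text \<open>Marginalisation: runs are independent, so discarding some leaves the product
  distribution of the rest. Discarded coordinates become 0, the default value of
  \<open>Pi_pmf\<close> in \<open>runs_pmf\<close>, so the distributions agree exactly.\<close>

lemma map_runs_pmf_restrict:
  assumes "finite C" "C' \<subseteq> C" "\<And>c. c \<in> C' \<Longrightarrow> s' c \<le> s c"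
  shows "map_pmf (\<lambda>\<omega> z. if z \<in> (SIGMA c:C'. {..<s' c}) then \<omega> z else 0) (runs_pmf \<rho> C s)
    = runs_pmf \<rho> C' s'"
  unfolding runs_pmf_def
  by (rule Pi_pmf_subset[symmetric]) (use assms in \<open>auto intro: less_le_trans\<close>)

text \<open>The coefficients do not depend on \<open>x\<close>, so the post-processing may use them.
  The map \<open>f m\<close> says which component of vector \<open>m\<close> enters component
  \<open>i\<close>; it only has to be valid where the coefficient is nonzero.\<close>

lemma computable_with_circuits_linear_combination:
  fixes \<rho> :: "'x \<Rightarrow> complex mat" and I :: "'m \<Rightarrow> 'i set" and f :: "'m \<Rightarrow> 'j \<Rightarrow> 'i"
    and a :: "'j \<Rightarrow> 'm \<Rightarrow> real"
  assumes M: "finite M" and A: "A \<subseteq> circuits_on n" and \<rho>: "\<And>x. density_mat (2 ^ n) (\<rho> x)"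
    and g: "\<And>m. m \<in> M \<Longrightarrow> computable_with_circuits A \<rho> (I m) (g m) (T m)"
    and f: "\<And>i m. i \<in> J \<Longrightarrow> m \<in> M \<Longrightarrow> a i m \<noteq> 0 \<Longrightarrow> f m i \<in> I m"
  shows "computable_with_circuits A \<rho> J (\<lambda>x i. \<Sum>m\<in>M. a i m * g m x (f m i)) (\<Sum>m\<in>M. T m)"
proof -
  define Q where "Q m C s post \<longleftrightarrow> C \<subseteq> A \<and> finite C \<and> card C \<le> T m \<and>
      (\<forall>x. \<forall>i\<in>I m. measure_pmf.expectation (runs_pmf (\<rho> x) C s) (\<lambda>\<omega>. post \<omega> i) = g m x i)"
    for m C s and post :: "(circuit \<times> nat \<Rightarrow> nat) \<Rightarrow> 'i \<Rightarrow> real"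
  have "\<exists>C s post. Q m C s post" if "m \<in> M" for m
    using g[OF that] unfolding computable_with_circuits_def Q_def .
  then obtain C s post where Q: "\<And>m. m \<in> M \<Longrightarrow> Q m (C m) (s m) (post m)"
    by metis
  have C: "\<And>m. m \<in> M \<Longrightarrow> C m \<subseteq> A" "\<And>m. m \<in> M \<Longrightarrow> finite (C m)" "\<And>m. m \<in> M \<Longrightarrow> card (C m) \<le> T m"
    and post: "\<And>m x i. m \<in> M \<Longrightarrow> i \<in> I m \<Longrightarrow>
      measure_pmf.expectation (runs_pmf (\<rho> x) (C m) (s m)) (\<lambda>\<omega>. post m \<omega> i) = g m x i"
    using Q by (simp_all add: Q_def)
  define D where "D = (\<Union>m\<in>M. C m)"
  \<comment> \<open>Any common upper bound of the \<open>s m c\<close> would do, since shots are not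
    counted.\<close>
  define t where "t c = (\<Sum>m\<in>M. s m c)" for c
  define r where "r m \<omega> z = (if z \<in> (SIGMA c:C m. {..<s m c}) then \<omega> z else 0)"
    for m and \<omega> :: "circuit \<times> nat \<Rightarrow> nat" and z
  have D: "D \<subseteq> A" "finite D" using C M by (auto simp: D_def)
  \<comment> \<open>A circuit shared by several of the \<open>C m\<close> is counted once on the
    left, hence only an inequality.\<close>
  have "card D \<le> (\<Sum>m\<in>M. card (C m))" unfolding D_def by (rule card_UN_le[OF M])
  also have "\<dots> \<le> (\<Sum>m\<in>M. T m)" by (intro sum_mono C)
  finally have card: "card D \<le> (\<Sum>m\<in>M. T m)" .
  have E: "measure_pmf.expectation (runs_pmf (\<rho> x) D t) (\<lambda>\<omega>. \<Sum>m\<in>M. a i m * post m (r m \<omega>) (f m i))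
      = (\<Sum>m\<in>M. a i m * g m x (f m i))" if i: "i \<in> J" for x i
  proof -
    let ?P = "runs_pmf (\<rho> x) D t"
    have int: "integrable ?P h" for h :: "(circuit \<times> nat \<Rightarrow> nat) \<Rightarrow> real"
      by (intro integrable_measure_pmf_finite finite_set_runs_pmf[OF \<rho>]) (use D A in auto)
    have "measure_pmf.expectation ?P (\<lambda>\<omega>. \<Sum>m\<in>M. a i m * post m (r m \<omega>) (f m i))
        = (\<Sum>m\<in>M. a i m * measure_pmf.expectation ?P (\<lambda>\<omega>. post m (r m \<omega>) (f m i)))"
      by (simp add: int)
    also have "\<dots> = (\<Sum>m\<in>M. a i m * g m x (f m i))"
    proof (rule sum.cong)
      fix m assume m: "m \<in> M"
      have "map_pmf (r m) ?P = runs_pmf (\<rho> x) (C m) (s m)"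
        unfolding r_def
        by (rule map_runs_pmf_restrict) (use D m M in \<open>auto simp: D_def t_def intro: member_le_sum\<close>)
      \<comment> \<open>Change of variables along \<open>r m\<close>.\<close>
      from this[symmetric] have "measure_pmf.expectation ?P (\<lambda>\<omega>. post m (r m \<omega>) (f m i))
          = measure_pmf.expectation (runs_pmf (\<rho> x) (C m) (s m)) (\<lambda>\<omega>. post m \<omega> (f m i))"
        by simp
      then show "a i m * measure_pmf.expectation ?P (\<lambda>\<omega>. post m (r m \<omega>) (f m i))
          = a i m * g m x (f m i)"
        \<comment> \<open>If \<open>a i m = 0\<close>, then \<open>f m i\<close> may lie outside
          \<open>I m\<close>, where \<open>post m\<close> need not be unbiased, but the term
          vanishes.\<close>
        using post[OF m f[OF i m]] by (cases "a i m = 0") auto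
    qed simp
    finally show ?thesis .
  qed
  show ?thesis
    unfolding computable_with_circuits_def
    by (intro exI[of _ D] exI[of _ t] exI[of _ "\<lambda>\<omega> i. \<Sum>m\<in>M. a i m * post m (r m \<omega>) (f m i)"])
      (use D card E in auto)
qed

lemma dim_evolve [simp]:
  "dim_row (evolve W \<rho>) = dim_row W" "dim_col (evolve W \<rho>) = dim_row W"
  by (simp_all add: evolve_def)

lemma expected_value_altdef:
  assumes "H \<in> carrier_mat N N" "\<sigma> \<in> carrier_mat N N"
  shows "expected_value H \<sigma> = Re (\<Sum>i<N. \<Sum>j<N. H $$ (i, j) * \<sigma> $$ (j, i))"
  using assms
  by (auto simp: expected_value_def mat_trace_def scalar_prod_def atLeast0LessThan
      simp del: Re_sum intro!: arg_cong[where f = Re] sum.cong)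

text \<open>Linearity of the trace, proved on entries because \<open>dqnn_state\<close> is defined
  entrywise: the sum over \<open>k\<close> moves outwards past \<open>j\<close> and then
  \<open>i\<close>.\<close>

lemma dqnn_loss_eq_sum:
  assumes "H \<in> carrier_mat (2 ^ n) (2 ^ n)"
    and "\<And>k. k \<in> {1..K} \<Longrightarrow> dim_row (U k (\<theta> k)) = 2 ^ n"
  shows "dqnn_loss H n K U \<theta> \<alpha> \<rho> = (\<Sum>k=1..K. \<alpha> k * expected_value H (evolve (U k (\<theta> k)) \<rho>))"
proof -
  let ?N = "2 ^ n :: nat"
  let ?e = "\<lambda>k. evolve (U k (\<theta> k)) \<rho>"
  have "dqnn_loss H n K U \<theta> \<alpha> \<rho>
      = Re (\<Sum>i<?N. \<Sum>j<?N. \<Sum>k=1..K. \<alpha> k * (H $$ (i, j) * ?e k $$ (j, i)))"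
    unfolding dqnn_loss_def
    by (subst expected_value_altdef[OF assms(1)])
      (auto simp: dqnn_state_def sum_distrib_left mult_ac simp del: Re_sum
        intro!: arg_cong[where f = Re] sum.cong)
  also have "(\<Sum>i<?N. \<Sum>j<?N. \<Sum>k=1..K. \<alpha> k * (H $$ (i, j) * ?e k $$ (j, i)))
      = (\<Sum>i<?N. \<Sum>k=1..K. \<Sum>j<?N. \<alpha> k * (H $$ (i, j) * ?e k $$ (j, i)))"
    by (intro sum.cong refl sum.swap)
  also have "\<dots> = (\<Sum>k=1..K. \<Sum>i<?N. \<Sum>j<?N. \<alpha> k * (H $$ (i, j) * ?e k $$ (j, i)))"
    by (rule sum.swap)
  also have "\<dots> = (\<Sum>k=1..K. \<alpha> k * (\<Sum>i<?N. \<Sum>j<?N. H $$ (i, j) * ?e k $$ (j, i)))"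
    by (simp add: sum_distrib_left)
  also have "Re \<dots> = (\<Sum>k=1..K. \<alpha> k * Re (\<Sum>i<?N. \<Sum>j<?N. H $$ (i, j) * ?e k $$ (j, i)))"
    by (subst Re_sum) (simp del: Re_sum)
  also have "\<dots> = (\<Sum>k=1..K. \<alpha> k * expected_value H (?e k))"
    using assms by (intro sum.cong refl) (subst expected_value_altdef[OF assms(1)], auto)
  finally show ?thesis .
qed

text \<open>Differentiability matters because \<open>deriv\<close> carries no information where no
  derivative exists. Updating \<open>w\<close> at \<open>p\<close> affects every \<open>f k\<close>
  that uses this name, so sharing needs no separate treatment.\<close>

lemma partial_linear_combination:
  fixes f :: "'k \<Rightarrow> ('p \<Rightarrow> real) \<Rightarrow> real"
  assumes "\<And>k. k \<in> S \<Longrightarrow> has_partial (f k) p w"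
  shows "partial (\<lambda>w'. \<Sum>k\<in>S. a k * f k w') p w = (\<Sum>k\<in>S. a k * partial (f k) p w)"
  unfolding partial_def
  by (intro DERIV_imp_deriv DERIV_sum DERIV_cmult field_differentiable_derivI)
    (use assms in \<open>simp add: has_partial_def\<close>)

text \<open>Components are indexed by positions \<open>(l, j)\<close>, not by names: a shared name
  occurs at several positions, each time with the full derivative of the loss with respect to
  it.\<close>

theorem proposition1:
  fixes n K :: nat
    and U :: "nat \<Rightarrow> real vec \<Rightarrow> complex mat"
    and d :: "nat \<Rightarrow> nat"
    and \<pi> :: "nat \<Rightarrow> nat \<Rightarrow> 'p"
    and w :: "'p \<Rightarrow> real"
    and \<alpha> :: "nat \<Rightarrow> real"
    and \<rho> :: "'x \<Rightarrow> complex mat"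
    and H :: "complex mat"
    and A :: "circuit set"
    and T :: "nat \<Rightarrow> nat \<Rightarrow> nat"
  assumes "K \<ge> 1"
    and "\<And>k v. k \<in> {1..K} \<Longrightarrow> v \<in> carrier_vec (d k) \<Longrightarrow> unitary_mat (2 ^ n) (U k v)"
    and "\<And>k. k \<in> {1..K} \<Longrightarrow> \<alpha> k \<ge> 0"
    and "(\<Sum>k=1..K. \<alpha> k) = 1"
    and "\<And>x. density_mat (2 ^ n) (\<rho> x)"
    and "hermitian_mat (2 ^ n) H"
    and "A \<subseteq> circuits_on n"
    and "\<And>l k j x. l \<in> {1..K} \<Longrightarrow> k \<in> {1..K} \<Longrightarrow> j < d l \<Longrightarrow>
      has_partial (\<lambda>w'. expected_value H (evolve (U k (params d \<pi> w' k)) (\<rho> x))) (\<pi> l j) w"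
    and "\<And>l k. l \<in> {1..K} \<Longrightarrow> k \<in> {1..K} \<Longrightarrow>
      computable_with_circuits A \<rho> {..<d l}
        (\<lambda>x j. partial (\<lambda>w'. expected_value H (evolve (U k (params d \<pi> w' k)) (\<rho> x))) (\<pi> l j) w)
        (T l k)"
  shows "computable_with_circuits A \<rho> (SIGMA l:{1..K}. {..<d l})
      (\<lambda>x (l, j). partial (\<lambda>w'. dqnn_loss H n K U (params d \<pi> w') \<alpha> (\<rho> x)) (\<pi> l j) w)
      (\<Sum>l=1..K. \<Sum>k=1..K. T l k)"
proof -
  let ?f = "\<lambda>k x w'. expected_value H (evolve (U k (params d \<pi> w' k)) (\<rho> x))"
  let ?M = "{1..K} \<times> {1..K}"
  let ?J = "SIGMA l:{1..K}. {..<d l}"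
  \<comment> \<open>Component \<open>(l, j)\<close> uses only the \<open>K\<close> vectors for
    \<open>l\<close>. The zero weight for other \<open>l'\<close> also excludes positions
    \<open>j\<close> that exceed \<open>d l'\<close>.\<close>
  let ?a = "\<lambda>(l, j) (l', k). if l = l' then \<alpha> k else 0"
  have H: "H \<in> carrier_mat (2 ^ n) (2 ^ n)" using assms(6) by (simp add: hermitian_mat_def)
  have dim: "dim_row (U k (params d \<pi> w' k)) = 2 ^ n" if "k \<in> {1..K}" for k w'
    using assms(2)[OF that, of "params d \<pi> w' k"] by (auto simp: params_def unitary_mat_def)
  have loss: "dqnn_loss H n K U (params d \<pi> w') \<alpha> (\<rho> x) = (\<Sum>k=1..K. \<alpha> k * ?f k x w')" for w' x
    by (intro dqnn_loss_eq_sum H dim)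
  have partial: "partial (\<lambda>w'. dqnn_loss H n K U (params d \<pi> w') \<alpha> (\<rho> x)) (\<pi> l j) w
      = (\<Sum>k=1..K. \<alpha> k * partial (?f k x) (\<pi> l j) w)" if "l \<in> {1..K}" "j < d l" for x l j
    unfolding loss
    by (rule partial_linear_combination) (use assms(8) that in blast)
  have sum: "(\<Sum>m\<in>?M. ?a (l, j) m * partial (?f (snd m) x) (\<pi> (fst m) j) w)
      = partial (\<lambda>w'. dqnn_loss H n K U (params d \<pi> w') \<alpha> (\<rho> x)) (\<pi> l j) w"
    if "l \<in> {1..K}" "j < d l" for x l j
  proof -
    have "(\<Sum>m\<in>?M. ?a (l, j) m * partial (?f (snd m) x) (\<pi> (fst m) j) w)
        = (\<Sum>l'=1..K. if l = l' then \<Sum>k=1..K. \<alpha> k * partial (?f k x) (\<pi> l' j) w else 0)"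
      unfolding sum.cartesian_product' by (rule sum.cong) auto
    then show ?thesis using that by (simp add: partial)
  qed
  have "computable_with_circuits A \<rho> ?J
      (\<lambda>x i. \<Sum>m\<in>?M. ?a i m * partial (?f (snd m) x) (\<pi> (fst m) (snd i)) w)
      (\<Sum>m\<in>?M. T (fst m) (snd m))"
    by (rule computable_with_circuits_linear_combination[where f = "\<lambda>m. snd"
          and I = "\<lambda>m. {..<d (fst m)}" and M = ?M and n = n
          and g = "\<lambda>m x j. partial (?f (snd m) x) (\<pi> (fst m) j) w"])
      (use assms(5,7,9) in \<open>auto split: if_splits\<close>)
  then show ?thesis
    \<comment> \<open>The fact \<open>sum\<close> identifies the two vectors only at indices in
      \<open>?J\<close>, so the definition, which tests just these, is unfolded.\<close>
    using sum by (simp add: computable_with_circuits_def Ball_def case_prod_unfold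
        sum.cartesian_product)
qed

end
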